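(* Let $0\le\alpha\le1$ and let $\mathcal N\subseteq\mathbb Z_+$ be locally $\alpha$-sparse. Then for each increasing sequence $\{t_k\}_{k\ge1}\subseteq(0,1)$ there exists a sequence $\Lambda=(\lambda_k)_{k\ge1}\subseteq\mathbb D$ such that $|\lambda_k|\ge t_k$ for every $k\ge1$ and $(\Lambda,\mathcal N)$ is a uniqueness pair for $\mathcal D_\alpha$. Moreover, for this $\Lambda$, if $\widetilde\Lambda\subseteq\mathbb D$ satisfies $$\inf_{\mu\in\widetilde\Lambda}\rho(\mu,\lambda_k)=o\left(\sqrt{1-|\lambda_k|}\right),\qquad k\to\infty,$$ then $(\widetilde\Lambda,\mathcal N)$ is also a uniqueness pair for $\mathcal D_\alpha$.
   Context: $\mathbb D=\{z\in\mathbb C:|z|<1\}$, $\mathbb Z_+=\{0,1,2,\dots\}$, $\mathbb N=\{1,2,\dots\}$. The pseudohyperbolic metric on $\mathbb D$ is $\rho(z,w)=\left|\frac{z-w}{1-\overline w z}\right|$. For an analytic function $f$ on $\mathbb D$, $\widehat f(k)$ denotes its $k$-th Taylor coefficient at $0$. For $0\le\alpha\le1$, the Dirichlet-type space $\mathcal D_\alpha$ is the Hilbert space of all analytic functions $f$ on $\mathbb D$ with $\|f\|_\alpha^2=\sum_{k\ge0}(k+1)^\alpha|\widehat f(k)|^2<\infty$. For $\Lambda\subseteq\mathbb D$ and $\mathcal N\subseteq\mathbb Z_+$, the pair $(\Lambda,\mathcal N)$ is a uniqueness pair for $\mathcal D_\alpha$ if the only $f\in\mathcal D_\alpha$ such that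 $f(\lambda)=0$ for all $\lambda\in\Lambda$ and $\widehat f(k)=0$ for all $k\in\mathbb Z_+\setminus\mathcal N$ is $f\equiv0$ (for a sequence $\Lambda$, this refers to its set of values). Sparsity: write a subset of $\mathbb Z_+$ in increasing order as $\{n_k\}_{k\ge1}$ (possibly finite). For $0<\alpha\le1$ it is $\alpha$-sparse if $\sum_{k\ge1} n_k^{-\alpha}<\infty$ (a term with $n_k=0$ is omitted from the sum; finite sets are $\alpha$-sparse). It is $0$-sparse if it is finite or satisfies $\sum_{k\ge1} n_k^2/n_{k+1}^2<\infty$. For $0\le\alpha\le1$, a set $\mathcal N\subseteq\mathbb Z_+$ is locally $\alpha$-sparse if for each $n\in\mathcal N$ there exists $q\in\mathbb N$ such that the set $\{m\in\mathcal N: m\equiv n \bmod q\}$ is $\alpha$-sparse. *)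

theory Defs
  imports "HOL-Complex_Analysis.Complex_Analysis" "HOL-Library.Landau_Symbols"
begin

text \<open>Functions on the unit disc are represented by total functions on the complex plane whose
  values outside \<open>ball 0 1\<close> are irrelevant; in particular, vanishing identically means vanishing on
  \<open>ball 0 1\<close>.\<close>

definition pseudohyperbolic :: "complex \<Rightarrow> complex \<Rightarrow> real" where
  "pseudohyperbolic z w = norm ((z - w) / (1 - cnj w * z))"

definition taylor_coeff :: "(complex \<Rightarrow> complex) \<Rightarrow> nat \<Rightarrow> complex" where
  "taylor_coeff f k = fps_nth (fps_expansion f 0) k"

definition dirichlet_space :: "real \<Rightarrow> (complex \<Rightarrow> complex) set" where
  "dirichlet_space \<alpha> =
     {f. f analytic_on ball 0 1 \<and>
         summable (\<lambda>k. real (k + 1) powr \<alpha> * (norm (taylor_coeff f k))\<^sup>2)}"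

definition uniqueness_pair :: "real \<Rightarrow> complex set \<Rightarrow> nat set \<Rightarrow> bool" where
  "uniqueness_pair \<alpha> L N \<longleftrightarrow>
     (\<forall>f \<in> dirichlet_space \<alpha>.
        (\<forall>z\<in>L. f z = 0) \<longrightarrow> (\<forall>k. k \<notin> N \<longrightarrow> taylor_coeff f k = 0) \<longrightarrow>
        (\<forall>z\<in>ball 0 1. f z = 0))"

text \<open>For \<open>\<alpha> = 0\<close> the order of the elements matters: \<open>enumerate N k\<close> is the element of
  the infinite set \<open>N\<close> with index \<open>k\<close> in increasing order, counting from 0. The denominators
  never vanish, as \<open>enumerate N (Suc k) > 0\<close>.\<close>

definition sparse :: "real \<Rightarrow> nat set \<Rightarrow> bool" where
  "sparse \<alpha> N \<longleftrightarrow>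
     (if \<alpha> = 0
      then finite N \<or>
           summable (\<lambda>k. (real (enumerate N k))\<^sup>2 / (real (enumerate N (Suc k)))\<^sup>2)
      else (\<lambda>n. real n powr (- \<alpha>)) summable_on (N - {0}))"

definition locally_sparse :: "real \<Rightarrow> nat set \<Rightarrow> bool" where
  "locally_sparse \<alpha> N \<longleftrightarrow>
     (\<forall>n\<in>N. \<exists>q\<ge>1. sparse \<alpha> {m\<in>N. m mod q = n mod q})"

end

theory Submission
  imports Defs
begin

text \<open>
  For \<open>n \<in> N\<close> and \<open>\<epsilon> > 0\<close> choose \<open>Q\<close> and \<open>\<phi>\<close> such that \<open>\<bar>1 + e\<^sup>i\<^sup>n\<^sup>\<phi>\<bar> \<ge> 1\<close> and
  \<open>\<Sum> (m + 1) powr (- \<alpha>) \<bar>1 + e\<^sup>i\<^sup>m\<^sup>\<phi>\<bar>\<^sup>2 \<le> \<epsilon>\<^sup>2\<close>, where \<open>m \<noteq> n\<close> ranges over the elements of \<open>N\<close> that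
  are congruent to \<open>n\<close> modulo \<open>Q\<close>. For \<open>\<alpha> > 0\<close> one takes \<open>\<phi> = 0\<close> and \<open>Q\<close> large. For \<open>\<alpha> = 0\<close> the
  remaining \<open>m\<close> form a lacunary sequence \<open>d\<close>, and \<open>\<phi>\<close> is the limit of successive approximations by
  odd multiples of \<open>\<pi> / d k\<close>, so that \<open>\<bar>1 + e\<^sup>i\<^sup>m\<^sup>\<phi>\<bar>\<close> is bounded by \<open>2\<pi>\<close> times the ratio of \<open>m\<close> to its
  successor.

  If \<open>f = \<Sum> a\<^sub>m z\<^sup>m\<close> vanishes at the \<open>2Q\<close> points \<open>r\<omega>\<close>, \<open>r\<omega>e\<^sup>i\<^sup>\<phi>\<close> with \<open>\<omega>\<close> a \<open>Q\<close>-th root of unity, then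
  averaging against \<open>\<omega>\<close> to the power \<open>-n\<close> gives \<open>\<Sum> a\<^sub>m r\<^sup>m (1 + e\<^sup>i\<^sup>m\<^sup>\<phi>) = 0\<close> over \<open>m\<close> congruent to \<open>n\<close>
  modulo \<open>Q\<close>, whence \<open>\<bar>a\<^sub>n\<bar> r\<^sup>n \<le> \<epsilon> \<parallel>f\<parallel>\<close> by Cauchy--Schwarz. Since \<open>r\<close> is arbitrary and may be chosen
  after \<open>Q\<close>, the countably many blocks of points fit any prescribed growth of \<open>\<bar>\<lambda>\<^sub>k\<bar>\<close>. For the perturbed
  zero set, a zero \<open>\<mu>\<close> near \<open>\<lambda>\<close> makes \<open>f(\<lambda>)\<close> small: subtracting the optimal multiple of the Szego
  kernel at \<open>\<mu>\<close> from the one at \<open>\<lambda>\<close> yields \<open>\<bar>f(\<lambda>)\<bar> \<le> \<parallel>f\<parallel> \<rho>(\<mu>,\<lambda>) / sqrt (1 - \<bar>\<lambda>\<bar>\<^sup>2)\<close>, and the average over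
  a block has total weight 2, independently of \<open>Q\<close>.
\<close>

section \<open>Cauchy--Schwarz and the Szego kernel estimate near a zero\<close>

lemma norm_sums_le_Cauchy_Schwarz:
  fixes h :: "nat \<Rightarrow> complex" and x y :: "nat \<Rightarrow> real"
  assumes h: "h sums X" and le: "\<And>m. norm (h m) \<le> x m * y m"
    and x: "\<And>m. 0 \<le> x m" and y: "\<And>m. 0 \<le> y m"
    and A: "\<And>K. (\<Sum>m<K. (x m)\<^sup>2) \<le> A" and B: "\<And>K. (\<Sum>m<K. (y m)\<^sup>2) \<le> B"
  shows "norm X \<le> sqrt A * sqrt B"
proof (rule LIMSEQ_le_const2)
  show "(\<lambda>K. norm (\<Sum>m<K. h m)) \<longlonglongrightarrow> norm X"
    using h unfolding sums_def by (rule tendsto_norm)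
  have "norm (\<Sum>m<K. h m) \<le> sqrt A * sqrt B" for K
  proof -
    have "norm (\<Sum>m<K. h m) \<le> (\<Sum>m<K. \<bar>x m\<bar> * \<bar>y m\<bar>)"
      using le x y by (intro sum_norm_le) simp
    also have "\<dots> \<le> L2_set x {..<K} * L2_set y {..<K}"
      by (rule L2_set_mult_ineq)
    also have "\<dots> \<le> sqrt A * sqrt B"
      unfolding L2_set_def
      by (intro mult_mono real_sqrt_le_mono A B real_sqrt_ge_zero sum_nonneg)
        (auto intro: order_trans[OF _ A[of 0]])
    finally show ?thesis .
  qed
  then show "\<exists>K0. \<forall>K\<ge>K0. norm (\<Sum>m<K. h m) \<le> sqrt A * sqrt B" by blast
qed

text \<open>The factor \<open>c\<close> is the inner product of the sequences \<open>z ^ m\<close>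
  and \<open>w ^ m\<close> divided by the squared norm of the latter. So \<open>c * w ^ m\<close> is
  the orthogonal projection of the kernel sequence at \<open>z\<close> onto the one at
  \<open>w\<close>, and the sum is the squared distance. Expanding the square gives four geometric
  series.\<close>

lemma pseudohyperbolic_kernel_sums:
  fixes z w :: complex
  assumes z: "norm z < 1" and w: "norm w < 1"
  defines "c \<equiv> (1 - (norm w)\<^sup>2) / (1 - z * cnj w)"
  shows "(\<lambda>m. (norm (z ^ m - c * w ^ m))\<^sup>2) sums ((pseudohyperbolic w z)\<^sup>2 / (1 - (norm z)\<^sup>2))"
proof -
  have lt: "norm (u * cnj v) < 1" if "norm u < 1" "norm v < 1" for u v :: complex
    using that mult_strict_mono'[of "norm u" 1 "norm v" 1] by (simp add: norm_mult)
  have ne: "1 - u * cnj v \<noteq> 0" if "norm u < 1" "norm v < 1" for u v :: complex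
    using lt[OF that] by auto
  have g: "(\<lambda>m. (u * cnj v) ^ m) sums (1 / (1 - u * cnj v))" if "norm u < 1" "norm v < 1" for u v :: complex
    using lt[OF that] by (rule geometric_sums)
  have sq: "complex_of_real ((norm u)\<^sup>2) = u * cnj u" for u
    by (simp add: complex_norm_square[symmetric])
  have c: "c = (1 - w * cnj w) / (1 - z * cnj w)"
    unfolding c_def by (simp add: sq[symmetric])
  let ?S = "1 / (1 - z * cnj z) - cnj c * (1 / (1 - z * cnj w)) - c * (1 / (1 - w * cnj z))
      + c * cnj c * (1 / (1 - w * cnj w))"
  have "(\<lambda>m. (z * cnj z) ^ m - cnj c * (z * cnj w) ^ m - c * (w * cnj z) ^ m
      + c * cnj c * (w * cnj w) ^ m) sums ?S"
    by (intro sums_add sums_diff sums_mult g z w)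
  also have "(\<lambda>m. (z * cnj z) ^ m - cnj c * (z * cnj w) ^ m - c * (w * cnj z) ^ m
      + c * cnj c * (w * cnj w) ^ m) = (\<lambda>m. complex_of_real ((norm (z ^ m - c * w ^ m))\<^sup>2))"
    unfolding sq by (auto simp: algebra_simps power_mult_distrib fun_eq_iff)
  also have "?S = complex_of_real ((pseudohyperbolic w z)\<^sup>2 / (1 - (norm z)\<^sup>2))"
  proof -
    have n: "1 - z * cnj z \<noteq> 0" "1 - w * cnj w \<noteq> 0" "1 - z * cnj w \<noteq> 0" "1 - w * cnj z \<noteq> 0"
      using ne z w by blast+
    have "complex_of_real ((pseudohyperbolic w z)\<^sup>2) = (w - z) / (1 - w * cnj z) * ((cnj w - cnj z) / (1 - z * cnj w))"
      unfolding pseudohyperbolic_def sq by (simp add: mult.commute)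
    then have "complex_of_real ((pseudohyperbolic w z)\<^sup>2 / (1 - (norm z)\<^sup>2)) =
      (w - z) / (1 - w * cnj z) * ((cnj w - cnj z) / (1 - z * cnj w)) / (1 - z * cnj z)"
      by (simp add: sq[symmetric])
    moreover have "cnj c = (1 - w * cnj w) / (1 - w * cnj z)"
      unfolding c by (simp add: mult.commute)
    \<comment> \<open>\<open>P\<close>, \<open>R\<close>, \<open>U\<close>, \<open>V\<close> stand
      for the four denominators in the order listed in \<open>n\<close>, so that
      \<open>c = R / U\<close> and \<open>cnj c = R / V\<close>.\<close>
    moreover have "1 / P - R / V * (1 / U) - R / U * (1 / V) + R / U * (R / V) * (1 / R) = (U * V - R * P) / (V * U * P)"
      if "P \<noteq> 0" "R \<noteq> 0" "U \<noteq> 0" "V \<noteq> 0" for P R U V :: complex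
      using that by (simp add: field_simps)
    note this[OF n]
    moreover have "(1 - z * cnj w) * (1 - w * cnj z) - (1 - w * cnj w) * (1 - z * cnj z) = (w - z) * (cnj w - cnj z)"
      by (simp add: algebra_simps)
    ultimately show ?thesis
      unfolding c by (simp only: times_divide_times_eq divide_divide_eq_left)
  qed
  finally show ?thesis by (simp only: sums_of_real_iff)
qed

text \<open>Since \<open>f w = 0\<close>, the value \<open>f z\<close> equals
  \<open>f z - c * f w\<close>, which pairs the coefficients with \<open>z ^ m - c * w ^ m\<close>.
  Cauchy--Schwarz and the kernel distance then give the bound.\<close>

lemma norm_le_pseudohyperbolic:
  fixes a :: "nat \<Rightarrow> complex"
  assumes f: "\<And>z. norm z < 1 \<Longrightarrow> (\<lambda>m. a m * z ^ m) sums f z"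
    and A: "\<And>K. (\<Sum>m<K. (norm (a m))\<^sup>2) \<le> A"
    and z: "norm z < 1" and w: "norm w < 1" and "f w = 0"
  shows "norm (f z) \<le> sqrt A * pseudohyperbolic w z / sqrt (1 - norm z)"
proof -
  define c where "c = (1 - (norm w)\<^sup>2) / (1 - z * cnj w)"
  let ?\<rho> = "pseudohyperbolic w z"
  note k = pseudohyperbolic_kernel_sums[OF z w, folded c_def]
  have \<rho>: "0 \<le> ?\<rho>" by (simp add: pseudohyperbolic_def)
  have "(\<lambda>m. a m * z ^ m - c * (a m * w ^ m)) sums (f z - c * f w)"
    by (intro sums_diff sums_mult f z w)
  then have "(\<lambda>m. a m * (z ^ m - c * w ^ m)) sums f z"
    using \<open>f w = 0\<close> by (simp add: algebra_simps)
  moreover have "(\<Sum>m<K. (norm (z ^ m - c * w ^ m))\<^sup>2) \<le> ?\<rho>\<^sup>2 / (1 - (norm z)\<^sup>2)" for K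
    unfolding sums_unique[OF k] by (intro sum_le_suminf sums_summable[OF k]) auto
  ultimately have "norm (f z) \<le> sqrt A * sqrt (?\<rho>\<^sup>2 / (1 - (norm z)\<^sup>2))"
    by (intro norm_sums_le_Cauchy_Schwarz[where x = "\<lambda>m. norm (a m)" and y = "\<lambda>m. norm (z ^ m - c * w ^ m)"])
      (use A in \<open>auto simp: norm_mult\<close>)
  also have "\<dots> = sqrt A * ?\<rho> / sqrt (1 - (norm z)\<^sup>2)"
    using \<rho> by (simp add: real_sqrt_divide)
  \<comment> \<open>The weaker denominator is the one in the little-o condition on the perturbed
    set.\<close>
  also have "\<dots> \<le> sqrt A * ?\<rho> / sqrt (1 - norm z)"
  proof (intro divide_left_mono mult_pos_pos mult_nonneg_nonneg real_sqrt_le_mono)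
    show "1 - norm z \<le> 1 - (norm z)\<^sup>2"
      using z by (simp add: power2_eq_square mult_left_le)
    show "0 < sqrt (1 - (norm z)\<^sup>2)"
      using z by (simp add: power_less_one_iff abs_square_less_1)
  qed (use z \<rho> A[of 0] in auto)
  finally show ?thesis .
qed

section \<open>Averaging over roots of unity\<close>

text \<open>A geometric sum of powers of a \<open>Q\<close>-th root of unity \<open>u\<close>, which
  is 1 exactly when \<open>m\<close> and \<open>n\<close> are congruent.\<close>

lemma sum_cis_residue:
  fixes m n Q :: nat
  assumes "Q \<ge> 1"
  shows "(\<Sum>i<Q. cis (2 * pi * i / Q * (real m - real n))) = (if m mod Q = n mod Q then of_nat Q else 0)"
proof -
  define u where "u = cis (2 * pi * (real m - real n) / Q)"
  have eq: "(\<Sum>i<Q. cis (2 * pi * i / Q * (real m - real n))) = (\<Sum>i<Q. u ^ i)"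
    unfolding u_def Complex.DeMoivre by (intro sum.cong refl) (simp add: algebra_simps)
  have "u ^ Q = cis (2 * pi * of_int (int m - int n))"
    unfolding u_def Complex.DeMoivre using assms by simp
  then have uQ: "u ^ Q = 1"
    by (simp only: cis_multiple_2pi Ints_of_int)
  have u1: "u = 1 \<longleftrightarrow> m mod Q = n mod Q"
  proof -
    have "u = 1 \<longleftrightarrow> (\<exists>k::int. 2 * pi * (real m - real n) / Q = 2 * pi * k)"
      unfolding u_def cis_conv_exp exp_eq_1 by (auto simp: mult.commute mult.left_commute)
    also have "\<dots> \<longleftrightarrow> (\<exists>k::int. real m - real n = Q * k)"
    proof (intro iff_exI)
      fix k :: int
      have "2 * pi * (real m - real n) / Q = 2 * pi * k \<longleftrightarrow> 2 * pi * (real m - real n) = 2 * pi * (Q * k)"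
        using assms by (auto simp: field_simps)
      then show "2 * pi * (real m - real n) / Q = 2 * pi * k \<longleftrightarrow> real m - real n = Q * k" by simp
    qed
    also have "\<dots> \<longleftrightarrow> (\<exists>k::int. int m - int n = int Q * k)"
      by (intro iff_exI) (metis (mono_tags) of_int_diff of_int_eq_iff of_int_mult of_int_of_nat_eq)
    also have "\<dots> \<longleftrightarrow> m mod Q = n mod Q"
      by (metis dvd_def mod_eq_dvd_iff of_nat_mod of_nat_eq_iff)
    finally show ?thesis .
  qed
  show ?thesis
    unfolding eq u1[symmetric] using uQ by (auto simp: sum_gp_strict)
qed

text \<open>Bounds one coefficient by the values on a single block of \<open>2 * Q\<close> points.
  The tolerance \<open>\<eta>\<close> admits functions that are only small on the block, as happens
  for perturbed zeros.\<close>

lemma norm_coeff_le_block: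
  fixes a :: "nat \<Rightarrow> complex" and \<alpha> r \<eta> \<epsilon> \<phi> :: real and n Q :: nat
  assumes f: "\<And>z. norm z < 1 \<Longrightarrow> (\<lambda>m. a m * z ^ m) sums f z"
    and A: "\<And>K. (\<Sum>m<K. real (m + 1) powr \<alpha> * (norm (a m))\<^sup>2) \<le> A"
    and N: "\<And>m. m \<notin> N \<Longrightarrow> a m = 0"
    and r: "0 < r" "r < 1" and Q: "Q \<ge> 1" and "0 \<le> \<epsilon>"
    and \<eta>: "\<And>i l::nat. i < Q \<Longrightarrow> l < 2 \<Longrightarrow> norm (f (of_real r * cis (2 * pi * i / Q + l * \<phi>))) \<le> \<eta>"
    and n: "norm (1 + cis (n * \<phi>)) \<ge> 1"
    and F: "\<And>F. finite F \<Longrightarrow> F \<subseteq> {m \<in> N. m mod Q = n mod Q \<and> m \<noteq> n} \<Longrightarrow>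
              (\<Sum>m\<in>F. real (m + 1) powr - \<alpha> * (norm (1 + cis (m * \<phi>)))\<^sup>2) \<le> \<epsilon>\<^sup>2"
  shows "norm (a n) * r ^ n \<le> 2 * \<eta> + sqrt A * \<epsilon>"
proof -
  define \<theta> where "\<theta> i = 2 * pi * i / Q" for i :: nat
  \<comment> \<open>The \<open>2 * Q\<close> values enter with weights of modulus
    \<open>1 / Q\<close>, total weight 2 whatever \<open>Q\<close> is.\<close>
  define X where "X = (\<Sum>i<Q. cis (- \<theta> i * n) / of_nat Q * (f (complex_of_real r * cis (\<theta> i)) + f (complex_of_real r * cis (\<theta> i + \<phi>))))"
  define g where "g m = (if m mod Q = n mod Q then 1 + cis (m * \<phi>) else 0)" for m
  have X: "norm X \<le> 2 * \<eta>"
  proof -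
    have "norm X \<le> (\<Sum>i<Q. 2 * \<eta> / Q)"
      unfolding X_def
    proof (rule sum_norm_le)
      fix i assume "i \<in> {..<Q}"
      then have i: "i < Q" by simp
      have "norm (f (complex_of_real r * cis (\<theta> i)) + f (complex_of_real r * cis (\<theta> i + \<phi>))) \<le> \<eta> + \<eta>"
        using \<eta>[OF i, of 0] \<eta>[OF i, of 1] unfolding \<theta>_def by (intro norm_triangle_mono) auto
      then show "norm (cis (- \<theta> i * n) / of_nat Q * (f (complex_of_real r * cis (\<theta> i)) + f (complex_of_real r * cis (\<theta> i + \<phi>)))) \<le> 2 * \<eta> / Q"
        using Q by (simp add: norm_mult norm_divide divide_simps)
    qed
    then show ?thesis using Q by simp
  qed
  have nr: "norm (complex_of_real r * cis x) < 1" for x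
    using r by (simp add: norm_mult)
  have "(\<lambda>m. \<Sum>i<Q. cis (- \<theta> i * n) / of_nat Q * (a m * (complex_of_real r * cis (\<theta> i)) ^ m + a m * (complex_of_real r * cis (\<theta> i + \<phi>)) ^ m)) sums X"
    unfolding X_def by (intro sums_sum sums_mult sums_add f nr)
  also have "(\<lambda>m. \<Sum>i<Q. cis (- \<theta> i * n) / of_nat Q * (a m * (complex_of_real r * cis (\<theta> i)) ^ m + a m * (complex_of_real r * cis (\<theta> i + \<phi>)) ^ m))
      = (\<lambda>m. a m * of_real r ^ m * g m)"
  proof
    fix m
    have "(\<Sum>i<Q. cis (- \<theta> i * n) / of_nat Q * (a m * (complex_of_real r * cis (\<theta> i)) ^ m + a m * (complex_of_real r * cis (\<theta> i + \<phi>)) ^ m))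
      = (\<Sum>i<Q. a m * of_real r ^ m * (1 + cis (m * \<phi>)) / of_nat Q * cis (2 * pi * i / Q * (real m - real n)))"
    proof (intro sum.cong refl)
      fix i
      have e: "cis (2 * pi * i / Q * (real m - real n)) = cis (- \<theta> i * n) * cis (\<theta> i) ^ m"
        unfolding \<theta>_def Complex.DeMoivre cis_mult by (simp add: algebra_simps diff_divide_distrib)
      have e': "cis (\<theta> i + \<phi>) ^ m = cis (\<theta> i) ^ m * cis (m * \<phi>)"
        unfolding Complex.DeMoivre cis_mult by (simp add: algebra_simps)
      show "cis (- \<theta> i * n) / of_nat Q * (a m * (complex_of_real r * cis (\<theta> i)) ^ m + a m * (complex_of_real r * cis (\<theta> i + \<phi>)) ^ m)
         = a m * of_real r ^ m * (1 + cis (m * \<phi>)) / of_nat Q * cis (2 * pi * i / Q * (real m - real n))"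
        unfolding e power_mult_distrib e' by (simp add: algebra_simps add_divide_distrib)
    qed
    also have "\<dots> = a m * of_real r ^ m * g m"
      unfolding sum_distrib_left[symmetric] sum_cis_residue[OF Q] g_def using Q by simp
    finally show "(\<Sum>i<Q. cis (- \<theta> i * n) / of_nat Q * (a m * (complex_of_real r * cis (\<theta> i)) ^ m + a m * (complex_of_real r * cis (\<theta> i + \<phi>)) ^ m))
      = a m * of_real r ^ m * g m" .
  qed
  \<comment> \<open>The term at \<open>n\<close> is split off; the rest of the residue class is what
    \<open>F\<close> controls.\<close>
  finally have "(\<lambda>m. a m * of_real r ^ m * g m - (if m = n then a m * of_real r ^ m * g m else 0)) sums (X - a n * of_real r ^ n * g n)"
    by (intro sums_diff sums_single)
  then have h: "(\<lambda>m. if m = n then 0 else a m * of_real r ^ m * g m) sums (X - a n * of_real r ^ n * g n)"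
    by (rule sums_cong[THEN iffD1, rotated]) simp
  let ?G = "{m \<in> N. m mod Q = n mod Q \<and> m \<noteq> n}"
  \<comment> \<open>Splits the weight evenly: one half goes to the Dirichlet norm of the
    coefficients, the other to the sum in \<open>F\<close>.\<close>
  have pw: "real (m + 1) powr (\<alpha> / 2) * real (m + 1) powr (- \<alpha> / 2) = 1" for m
    by (simp flip: powr_add)
  have "norm (X - a n * of_real r ^ n * g n) \<le> sqrt A * sqrt (\<epsilon>\<^sup>2)"
  proof (rule norm_sums_le_Cauchy_Schwarz[OF h,
        where x = "\<lambda>m. real (m + 1) powr (\<alpha> / 2) * norm (a m)" and
          y = "\<lambda>m. if m \<in> ?G then real (m + 1) powr (- \<alpha> / 2) * norm (1 + cis (m * \<phi>)) else 0"])
    fix m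
    have rm: "r ^ m \<le> 1" using r by (simp add: power_le_one)
    show "norm (if m = n then 0 else a m * complex_of_real r ^ m * g m) \<le>
      real (m + 1) powr (\<alpha> / 2) * norm (a m) *
      (if m \<in> ?G then real (m + 1) powr (- \<alpha> / 2) * norm (1 + cis (m * \<phi>)) else 0)"
    proof (cases "m \<in> ?G")
      case True
      have "norm (a m) * r ^ m * norm (1 + cis (m * \<phi>)) \<le> norm (a m) * 1 * norm (1 + cis (m * \<phi>))"
        by (intro mult_mono rm) (use r in auto)
      also have "\<dots> = (real (m + 1) powr (\<alpha> / 2) * real (m + 1) powr (- \<alpha> / 2)) * (norm (a m) * norm (1 + cis (m * \<phi>)))"
        unfolding pw by simp
      finally show ?thesis
        using True r by (simp add: g_def norm_mult norm_power mult_ac)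
    next
      case False
      then show ?thesis using N[of m] by (auto simp: g_def)
    qed
  next
    fix K
    show "(\<Sum>m<K. (real (m + 1) powr (\<alpha> / 2) * norm (a m))\<^sup>2) \<le> A"
      using A[of K] by (simp add: power_mult_distrib flip: powr_power)
        (simp add: powr_power)
    have "(\<Sum>m<K. (if m \<in> ?G then real (m + 1) powr (- \<alpha> / 2) * norm (1 + cis (m * \<phi>)) else 0)\<^sup>2)
      = (\<Sum>m\<in>{..<K} \<inter> ?G. real (m + 1) powr - \<alpha> * (norm (1 + cis (m * \<phi>)))\<^sup>2)"
      by (subst sum.inter_restrict) (auto intro!: sum.cong simp: power_mult_distrib powr_power)
    also have "\<dots> \<le> \<epsilon>\<^sup>2" by (rule F) auto
    finally show "(\<Sum>m<K. (if m \<in> ?G then real (m + 1) powr (- \<alpha> / 2) * norm (1 + cis (m * \<phi>)) else 0)\<^sup>2) \<le> \<epsilon>\<^sup>2" .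
  qed auto
  then have "norm (X - a n * of_real r ^ n * g n) \<le> sqrt A * \<epsilon>"
    using \<open>0 \<le> \<epsilon>\<close> by simp
  moreover have "norm (a n) * r ^ n * 1 \<le> norm (a n) * r ^ n * norm (1 + cis (n * \<phi>))"
    using n r by (intro mult_left_mono) auto
  moreover have "norm (a n) * r ^ n * norm (1 + cis (n * \<phi>)) = norm (a n * of_real r ^ n * g n)"
    using r by (simp add: g_def norm_mult norm_power)
  moreover have "norm (a n * of_real r ^ n * g n) \<le> norm X + norm (X - a n * of_real r ^ n * g n)"
    by (metis norm_minus_commute norm_triangle_sub add.commute)
  ultimately show ?thesis using X by linarith
qed

section \<open>Choice of the modulus and the angle\<close>

lemma summable_finite_tail:
  fixes g :: "nat \<Rightarrow> real"
  assumes "summable g" and pos: "\<And>k. 0 \<le> g k" and "0 < e"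
  obtains K where "\<And>F. finite F \<Longrightarrow> F \<subseteq> {K..} \<Longrightarrow> sum g F \<le> e"
proof -
  obtain K where K: "\<And>m n. m \<ge> K \<Longrightarrow> norm (sum g {m..<n}) < e"
    using assms(1,3) unfolding summable_Cauchy by meson
  have "sum g F \<le> e" if "finite F" "F \<subseteq> {K..}" for F
  proof -
    have "sum g F \<le> sum g {K..<Suc (Max F)}"
      using that pos by (intro sum_mono2) (auto simp: less_Suc_eq_le)
    also have "\<dots> \<le> e" using K[of K "Suc (Max F)"] by simp
    finally show ?thesis .
  qed
  then show thesis by (rule that)
qed

lemma norm_cis_diff_le: "norm (cis x - cis y) \<le> \<bar>x - y\<bar>"
proof -
  have "cis x - cis y = cis y * (cis (x - y) - 1)"
    by (simp add: algebra_simps cis_mult)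
  then have "norm (cis x - cis y) = dist (cis (x - y)) (cis 0)"
    by (simp add: norm_mult dist_norm)
  also have "\<dots> = norm (exp (\<i> * of_real (x - y)) - 1)"
    by (simp add: dist_norm cis_conv_exp)
  also have "\<dots> \<le> \<bar>x - y\<bar>"
    unfolding dist_exp_i_1 using abs_sin_x_le_abs_x[of "(x - y) / 2"] by simp
  finally show ?thesis .
qed

text \<open>Odd multiples of \<open>pi / d\<close> are spaced \<open>2 * pi / d\<close> apart. The
  witness \<open>y\<close> is the midpoint of the period interval that contains
  \<open>x\<close>.\<close>

lemma nearby_odd_multiple:
  fixes d x :: real
  assumes "d > 0"
  obtains y where "\<bar>y - x\<bar> \<le> pi / d" and "cis (d * y) = - 1"
proof
  define k where "k = \<lfloor>d * x / (2 * pi)\<rfloor>"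
  define y where "y = (2 * pi * k + pi) / d"
  have "k \<le> d * x / (2 * pi)" "d * x / (2 * pi) < k + 1"
    unfolding k_def by linarith+
  then have "2 * pi * k \<le> d * x" "d * x < 2 * pi * k + 2 * pi"
    by (auto simp: field_simps)
  then have "\<bar>d * y - d * x\<bar> \<le> pi"
    unfolding y_def using assms by simp
  moreover have "\<bar>d * y - d * x\<bar> = \<bar>y - x\<bar> * d"
    using assms by (simp add: abs_mult mult.commute flip: right_diff_distrib)
  ultimately show "\<bar>y - x\<bar> \<le> pi / d"
    using assms by (simp add: pos_le_divide_eq)
  have "cis (d * y) = cis (2 * pi * of_int k) * cis pi"
    unfolding y_def cis_mult using assms by simp
  then show "cis (d * y) = - 1" by (simp add: cis_multiple_2pi)
qed

text \<open>Stage \<open>k\<close> corrects the angle so that \<open>d k\<close> is treated exactly.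
  As \<open>d\<close> at least doubles, all later corrections add up to at most
  \<open>2 * pi / d (Suc k)\<close>, which disturbs the phase \<open>d k * \<phi>\<close> by at most
  \<open>d k\<close> times that.\<close>

lemma lacunary_angle:
  fixes d :: "nat \<Rightarrow> real"
  assumes d0: "d 0 > 0" and d: "\<And>k. d (Suc k) \<ge> 2 * d k"
  obtains \<phi> where "\<bar>\<phi>\<bar> \<le> 2 * pi / d 0"
    and "\<And>k. norm (1 + cis (d k * \<phi>)) \<le> 2 * pi * (d k / d (Suc k))"
proof -
  have pos: "d k > 0" for k
    by (induction k) (use d0 d in \<open>auto intro: less_le_trans[of 0 "2 * d _"]\<close>)
  define nxt where "nxt k x = (SOME y. \<bar>y - x\<bar> \<le> pi / d k \<and> cis (d k * y) = - 1)" for k and x :: real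
  have nxt: "\<bar>nxt k x - x\<bar> \<le> pi / d k \<and> cis (d k * nxt k x) = - 1" for k x
    unfolding nxt_def by (rule someI_ex) (meson nearby_odd_multiple pos)
  define p where "p = rec_nat 0 nxt"
  have p0: "p 0 = 0" and pS: "p (Suc k) = nxt k (p k)" for k
    by (simp_all add: p_def)
  have pow: "d (k + j) \<ge> 2 ^ j * d k" for k j
  proof (induction j)
    case (Suc j)
    then show ?case using d[of "k + j"] by simp
  qed simp
  have step: "\<bar>p (Suc k + j) - p (k + j)\<bar> \<le> pi / d k * (1 / 2) ^ j" for k j
  proof -
    have "\<bar>p (Suc k + j) - p (k + j)\<bar> \<le> pi / d (k + j)"
      using nxt[of "k + j" "p (k + j)"] by (simp add: pS)
    also have "\<dots> \<le> pi / (2 ^ j * d k)"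
      using pow[where k = k and j = j] pos by (intro divide_left_mono) auto
    finally show ?thesis by (simp add: field_simps)
  qed
  have dist: "\<bar>p (k + j) - p k\<bar> \<le> 2 * pi / d k" for k j
  proof -
    \<comment> \<open>The factor \<open>2 - 2 * (1 / 2) ^ j\<close> is the exact partial geometric
      sum, which makes the induction close.\<close>
    have "\<bar>p (k + j) - p k\<bar> \<le> pi / d k * (2 - 2 * (1 / 2) ^ j)"
    proof (induction j)
      case (Suc j)
      have "\<bar>p (k + Suc j) - p k\<bar> \<le> \<bar>p (Suc k + j) - p (k + j)\<bar> + \<bar>p (k + j) - p k\<bar>" by simp
      also have "\<dots> \<le> pi / d k * (1 / 2) ^ j + pi / d k * (2 - 2 * (1 / 2) ^ j)"
        by (intro add_mono Suc.IH step)
      also have "\<dots> = pi / d k * (2 - 2 * (1 / 2) ^ Suc j)" by (simp add: algebra_simps)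
      finally show ?case .
    qed simp
    also have "\<dots> \<le> pi / d k * 2"
      using pos[of k] by (intro mult_left_mono) auto
    finally show ?thesis by (simp add: mult.commute)
  qed
  have "summable (\<lambda>j. p (Suc j) - p j)"
  proof (rule summable_comparison_test')
    show "summable (\<lambda>j. pi / d 0 * (1 / 2) ^ j)" by (intro summable_mult summable_geometric) simp
    show "norm (p (Suc j) - p j) \<le> pi / d 0 * (1 / 2) ^ j" if "j \<ge> 0" for j
      using step[of 0 j] by simp
  qed
  then have "convergent p"
    by (simp add: summable_iff_convergent sum_lessThan_telescope p0)
  then obtain \<phi> where \<phi>: "p \<longlonglongrightarrow> \<phi>" by (auto simp: convergent_def)
  have lim: "\<bar>\<phi> - p k\<bar> \<le> 2 * pi / d k" for k
  proof (rule LIMSEQ_le_const2)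
    show "(\<lambda>j. \<bar>p (k + j) - p k\<bar>) \<longlonglongrightarrow> \<bar>\<phi> - p k\<bar>"
      using LIMSEQ_ignore_initial_segment[OF \<phi>, of k]
      by (intro tendsto_intros) (simp add: add.commute)
  qed (use dist in blast)
  show thesis
  proof
    show "\<bar>\<phi>\<bar> \<le> 2 * pi / d 0" using lim[of 0] by (simp add: p0)
    fix k
    \<comment> \<open>The approximation exact for \<open>d k\<close> is \<open>p (Suc k)\<close>,
      not \<open>p k\<close>; hence the gain of the ratio \<open>d k / d (Suc k)\<close>.\<close>
    have "1 + cis (d k * \<phi>) = cis (d k * \<phi>) - cis (d k * p (Suc k))"
      using nxt[of k "p k"] by (simp add: pS)
    then have "norm (1 + cis (d k * \<phi>)) \<le> \<bar>d k * \<phi> - d k * p (Suc k)\<bar>"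
      using norm_cis_diff_le by metis
    also have "\<dots> = d k * \<bar>\<phi> - p (Suc k)\<bar>"
      using pos[of k] by (simp add: abs_mult flip: right_diff_distrib)
    also have "\<dots> \<le> d k * (2 * pi / d (Suc k))"
      using pos[of k] lim[of "Suc k"] by (intro mult_left_mono) auto
    finally show "norm (1 + cis (d k * \<phi>)) \<le> 2 * pi * (d k / d (Suc k))" by (simp add: mult_ac)
  qed
qed

text \<open>Passing from \<open>q\<close> to a large multiple of it removes every small element of
  the class except \<open>n\<close>, so only a tail of the sparse set remains.\<close>

lemma locally_sparse_block:
  fixes N :: "nat set" and \<alpha> \<epsilon> :: real
  assumes "0 \<le> \<alpha>" and N: "locally_sparse \<alpha> N" and n: "n \<in> N" and "0 < \<epsilon>"
  obtains Q :: nat and \<phi> :: real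
  where "Q \<ge> 1" and "norm (1 + cis (n * \<phi>)) \<ge> 1"
    and "\<And>F. finite F \<Longrightarrow> F \<subseteq> {m \<in> N. m mod Q = n mod Q \<and> m \<noteq> n} \<Longrightarrow>
           (\<Sum>m\<in>F. real (m + 1) powr - \<alpha> * (norm (1 + cis (m * \<phi>)))\<^sup>2) \<le> \<epsilon>"
proof -
  obtain q where q: "q \<ge> 1" and sp: "sparse \<alpha> {m\<in>N. m mod q = n mod q}"
    using N n unfolding locally_sparse_def by blast
  define A where "A = {m\<in>N. m mod q = n mod q}"
  \<comment> \<open>The modulus exceeds \<open>n\<close>, so any other member of the class is at
    least the modulus, which exceeds both \<open>L\<close> and \<open>n\<close>.\<close>
  have far: "m \<in> A \<and> m > L \<and> m > n"
    if "m \<in> N" "m mod (q * (L + n + 1)) = n mod (q * (L + n + 1))" "m \<noteq> n" for m L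
  proof -
    have "L + n + 1 \<le> q * (L + n + 1)" using q by (cases q) auto
    moreover have "m \<ge> q * (L + n + 1)"
    proof (rule ccontr)
      assume "\<not> m \<ge> q * (L + n + 1)"
      then show False using that calculation by simp
    qed
    moreover have "m mod q = n mod q"
      by (metis that(2) mod_mod_cancel dvd_triv_left)
    ultimately show ?thesis using that by (auto simp: A_def)
  qed
  have Q: "q * (L + n + 1) \<ge> 1" for L using q by simp
  show thesis
  proof (cases "\<alpha> = 0")
    case False
    define g where "g m = (if m \<in> A - {0} then real m powr - \<alpha> else 0)" for m
    have "(\<lambda>m. real m powr - \<alpha>) summable_on (A - {0})"
      using sp False by (simp add: sparse_def A_def)
    then have "g summable_on UNIV"
      by (rule summable_on_cong_neutral[THEN iffD1, rotated -1]) (auto simp: g_def)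
    then have "summable g" by (rule summable_on_imp_summable)
    \<comment> \<open>The divisor 4 is the squared norm of \<open>1 + cis 0\<close>.\<close>
    then obtain L where L: "\<And>F. finite F \<Longrightarrow> F \<subseteq> {L..} \<Longrightarrow> sum g F \<le> \<epsilon> / 4"
      by (rule summable_finite_tail[where e = "\<epsilon> / 4"]) (use \<open>0 < \<epsilon>\<close> in \<open>auto simp: g_def\<close>)
    show thesis
    proof (rule that[OF Q[of L], of 0])
      fix F assume F: "finite F" "F \<subseteq> {m \<in> N. m mod (q * (L + n + 1)) = n mod (q * (L + n + 1)) \<and> m \<noteq> n}"
      have m: "m \<in> A \<and> m > L \<and> m > n" if "m \<in> F" for m using far F that by blast
      have "(\<Sum>m\<in>F. real (m + 1) powr - \<alpha> * (norm (1 + cis (real m * 0)))\<^sup>2) \<le> (\<Sum>m\<in>F. 4 * g m)"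
      proof (rule sum_mono)
        fix m assume "m \<in> F"
        then have "m \<in> A" "m > 0" using m by fastforce+
        moreover have "real (m + 1) powr - \<alpha> \<le> real m powr - \<alpha>"
          using \<open>m > 0\<close> \<open>0 \<le> \<alpha>\<close> by (intro powr_mono2') auto
        ultimately show "real (m + 1) powr - \<alpha> * (norm (1 + cis (real m * 0)))\<^sup>2 \<le> 4 * g m"
          by (simp add: g_def)
      qed
      also have "\<dots> = 4 * sum g F" by (simp add: sum_distrib_left)
      also have "\<dots> \<le> \<epsilon>" using L[OF F(1)] m by (simp add: subset_iff less_imp_le)
      finally show "(\<Sum>m\<in>F. real (m + 1) powr - \<alpha> * (norm (1 + cis (real m * 0)))\<^sup>2) \<le> \<epsilon>" .
    qed simp
  next
    case True
    show thesis
    proof (cases "finite A")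
      case fin: True
      define L where "L = Max A"
      have L: "m \<le> L" if "m \<in> A" for m
        unfolding L_def using fin that by (rule Max_ge)
      show thesis
      proof (rule that[OF Q[of L], of 0])
        fix F assume F: "finite F" "F \<subseteq> {m \<in> N. m mod (q * (L + n + 1)) = n mod (q * (L + n + 1)) \<and> m \<noteq> n}"
        have "F = {}" using far L F(2) by fastforce
        then show "(\<Sum>m\<in>F. real (m + 1) powr - \<alpha> * (norm (1 + cis (real m * 0)))\<^sup>2) \<le> \<epsilon>"
          using \<open>0 < \<epsilon>\<close> by simp
      qed simp
    next
      case inf: False
      define e where "e k = real (enumerate A k)" for k
      define g where "g k = (e k)\<^sup>2 / (e (Suc k))\<^sup>2" for k
      have e_ge: "e k \<ge> k" for k using le_enumerate[OF inf, of k] by (simp add: e_def)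
      have sum: "summable g"
        using sp True inf by (simp add: sparse_def A_def g_def[abs_def] e_def[abs_def])
      have g0: "0 \<le> g k" for k by (simp add: g_def)
      \<comment> \<open>Compensates the squared constant \<open>2 * pi\<close> of
        \<open>lacunary_angle\<close>.\<close>
      define \<delta> where "\<delta> = \<epsilon> / (4 * pi\<^sup>2)"
      have \<delta>: "0 < \<delta>" using \<open>0 < \<epsilon>\<close> by (simp add: \<delta>_def)
      obtain K1 where K1: "\<And>F. finite F \<Longrightarrow> F \<subseteq> {K1..} \<Longrightarrow> sum g F \<le> \<delta>"
        using summable_finite_tail[OF sum g0 \<delta>] by blast
      obtain K2 where K2: "\<And>F. finite F \<Longrightarrow> F \<subseteq> {K2..} \<Longrightarrow> sum g F \<le> 1 / 4"
        using summable_finite_tail[OF sum g0, of "1 / 4"] by auto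
      \<comment> \<open>\<open>K1\<close> makes the tail small, \<open>K2\<close> makes the sequence
        at least double, \<open>8 * n\<close> keeps the phase \<open>n * \<phi>\<close> below 1 in
        modulus since \<open>2 * pi < 8\<close>, and the final 1 makes \<open>d 0\<close>
        positive.\<close>
      define K where "K = K1 + K2 + 8 * n + 1"
      have Kge: "K \<ge> K1" "K \<ge> K2" "K \<ge> 8 * n" "K \<ge> 1" by (auto simp: K_def)
      define d where "d k = e (K + k)" for k
      have d0: "d 0 \<ge> 8 * n" "d 0 > 0"
        using e_ge[of K] Kge by (simp_all add: d_def)
      have dS: "d (Suc k) \<ge> 2 * d k" for k
      proof -
        have "g (K + k) \<le> 1 / 4" using K2[of "{K + k}"] Kge by simp
        moreover have "e (Suc (K + k)) > 0" using e_ge[of "Suc (K + k)"] by simp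
        ultimately have "(2 * e (K + k))\<^sup>2 \<le> (e (Suc (K + k)))\<^sup>2"
          by (simp add: g_def field_simps power2_eq_square)
        then have "2 * e (K + k) \<le> e (Suc (K + k))"
          by (rule power2_le_imp_le) (use \<open>e (Suc (K + k)) > 0\<close> in simp)
        then show ?thesis by (simp add: d_def)
      qed
      obtain \<phi> where \<phi>: "\<bar>\<phi>\<bar> \<le> 2 * pi / d 0"
        and \<phi>d: "\<And>k. norm (1 + cis (d k * \<phi>)) \<le> 2 * pi * (d k / d (Suc k))"
        using lacunary_angle[OF d0(2) dS] by blast
      define L where "L = enumerate A K"
      show thesis
      proof (rule that[OF Q[of L], of \<phi>])
        have "norm (1 - cis (n * \<phi>)) \<le> \<bar>n * \<phi>\<bar>"
          using norm_cis_diff_le[of 0 "n * \<phi>"] by simp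
        also have "\<dots> \<le> n * (2 * pi / d 0)"
          unfolding abs_mult using \<phi> by (intro mult_mono) auto
        also have "\<dots> \<le> 1"
        proof -
          have "n * (2 * pi) \<le> real n * 8" using pi_less_4 by (intro mult_left_mono) auto
          then show ?thesis using d0 by (simp add: field_simps)
        qed
        finally have "norm (1 - cis (n * \<phi>)) \<le> 1" .
        \<comment> \<open>The numbers \<open>1 - cis (n * \<phi>)\<close> and
          \<open>1 + cis (n * \<phi>)\<close> add up to 2, so the second is large when the first is
          small.\<close>
        moreover have "norm (2 :: complex) \<le> norm (1 - cis (n * \<phi>)) + norm (1 + cis (n * \<phi>))"
          by (rule order_trans[OF _ norm_triangle_ineq]) simp
        ultimately show "norm (1 + cis (n * \<phi>)) \<ge> 1" by simp
      next
        fix F assume F: "finite F" "F \<subseteq> {m \<in> N. m mod (q * (L + n + 1)) = n mod (q * (L + n + 1)) \<and> m \<noteq> n}"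
        \<comment> \<open>Pulled back to indices, \<open>F\<close> lies beyond \<open>K\<close>,
          because its elements exceed \<open>L = enumerate A K\<close>.\<close>
        define G where "G = enumerate A -` F"
        have inj: "inj (enumerate A)" using inf by (simp add: strict_mono_enumerate strict_mono_imp_inj_on)
        have "F \<subseteq> range (enumerate A)" using far F(2) range_enumerate[OF inf] by blast
        then have FG: "F = enumerate A ` G" unfolding G_def by auto
        have G: "finite G" unfolding G_def using F(1) inj by (simp add: finite_vimageI)
        have GK: "k \<ge> K" if "k \<in> G" for k
        proof -
          have "enumerate A k > enumerate A K"
            using that far[of "enumerate A k" L] F(2) unfolding G_def L_def by blast
          then show ?thesis using enumerate_mono_iff[OF inf] by (simp add: less_imp_le)
        qed
        have "(\<Sum>m\<in>F. real (m + 1) powr - \<alpha> * (norm (1 + cis (m * \<phi>)))\<^sup>2)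
          = (\<Sum>k\<in>G. (norm (1 + cis (e k * \<phi>)))\<^sup>2)"
          unfolding FG True using inj by (subst sum.reindex) (auto simp: e_def intro: inj_on_subset)
        also have "\<dots> \<le> (\<Sum>k\<in>G. 4 * pi\<^sup>2 * g k)"
        proof (rule sum_mono)
          fix k assume "k \<in> G"
          then obtain i where i: "k = K + i" using GK le_iff_add by blast
          have "(norm (1 + cis (e k * \<phi>)))\<^sup>2 \<le> (2 * pi * (d i / d (Suc i)))\<^sup>2"
            using \<phi>d[of i] by (intro power_mono) (simp_all add: d_def i)
          also have "\<dots> = 4 * pi\<^sup>2 * g k"
            by (simp add: g_def d_def i power_mult_distrib power_divide)
          finally show "(norm (1 + cis (e k * \<phi>)))\<^sup>2 \<le> 4 * pi\<^sup>2 * g k" .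
        qed
        also have "\<dots> = 4 * pi\<^sup>2 * sum g G" by (simp add: sum_distrib_left)
        also have "\<dots> \<le> 4 * pi\<^sup>2 * \<delta>"
          using K1[OF G] GK Kge(1) by (intro mult_left_mono) (auto simp: subset_iff intro: order_trans)
        also have "\<dots> = \<epsilon>" by (simp add: \<delta>_def)
        finally show "(\<Sum>m\<in>F. real (m + 1) powr - \<alpha> * (norm (1 + cis (m * \<phi>)))\<^sup>2) \<le> \<epsilon>" .
      qed
    qed
  qed
qed

section \<open>From blocks to uniqueness pairs\<close>

lemma dirichlet_space_taylor:
  assumes "f \<in> dirichlet_space \<alpha>"
  shows "norm z < 1 \<Longrightarrow> (\<lambda>m. taylor_coeff f m * z ^ m) sums f z"
    and "summable (\<lambda>k. real (k + 1) powr \<alpha> * (norm (taylor_coeff f k))\<^sup>2)"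
proof -
  have f: "f holomorphic_on ball 0 1"
    using assms by (simp add: dirichlet_space_def analytic_imp_holomorphic)
  show "(\<lambda>m. taylor_coeff f m * z ^ m) sums f z" if "norm z < 1"
    using holomorphic_power_series[OF f, of z] that
    by (simp add: taylor_coeff_def fps_expansion_def)
qed (use assms in \<open>simp add: dirichlet_space_def\<close>)

text \<open>Each \<open>n\<close> owns infinitely many blocks, block \<open>j\<close> with precision
  \<open>1 / Suc j\<close>; letting \<open>j\<close> grow forces the coefficient at \<open>n\<close>
  to vanish. The lower bound on \<open>r\<close> keeps \<open>r n j ^ n\<close> away from 0
  meanwhile. \<open>M\<close> is nonempty so that a real infimum near 0 yields a point of
  \<open>M\<close>.\<close>

lemma uniqueness_pair_blocks:
  fixes Q :: "nat \<Rightarrow> nat \<Rightarrow> nat" and \<phi> r :: "nat \<Rightarrow> nat \<Rightarrow> real" and \<Lambda> :: "nat \<Rightarrow> complex"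
  assumes "0 \<le> \<alpha>"
    and Q: "\<And>n j. n \<in> N \<Longrightarrow> Q n j \<ge> 1"
    and \<phi>: "\<And>n j. n \<in> N \<Longrightarrow> norm (1 + cis (n * \<phi> n j)) \<ge> 1"
    and F: "\<And>n j F. n \<in> N \<Longrightarrow> finite F \<Longrightarrow> F \<subseteq> {m \<in> N. m mod Q n j = n mod Q n j \<and> m \<noteq> n} \<Longrightarrow>
           (\<Sum>m\<in>F. real (m + 1) powr - \<alpha> * (norm (1 + cis (m * \<phi> n j)))\<^sup>2) \<le> (1 / Suc j)\<^sup>2"
    and r: "\<And>n j. 1 / 2 \<le> r n j \<and> r n j < 1"
    and \<Lambda>: "\<And>n j (i::nat) (l::nat). n \<in> N \<Longrightarrow> i < Q n j \<Longrightarrow> l < 2 \<Longrightarrow>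
           \<Lambda> (prod_encode (prod_encode (n, j), prod_encode (i, l))) =
             of_real (r n j) * cis (2 * pi * i / Q n j + l * \<phi> n j)"
    and \<Lambda>1: "\<And>k. norm (\<Lambda> k) < 1"
    and M: "M \<subseteq> ball 0 1" "M \<noteq> {}"
    and o: "(\<lambda>k. INF \<mu>\<in>M. pseudohyperbolic \<mu> (\<Lambda> k)) \<in> o(\<lambda>k. sqrt (1 - norm (\<Lambda> k)))"
  shows "uniqueness_pair \<alpha> M N"
  unfolding uniqueness_pair_def
proof (intro ballI impI)
  fix f and z :: complex
  assume fD: "f \<in> dirichlet_space \<alpha>" and fM: "\<forall>z\<in>M. f z = 0"
    and fN: "\<forall>k. k \<notin> N \<longrightarrow> taylor_coeff f k = 0" and z: "z \<in> ball 0 1"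
  define a where "a = taylor_coeff f"
  note f = dirichlet_space_taylor(1)[OF fD, folded a_def]
  define A where "A = (\<Sum>k. real (k + 1) powr \<alpha> * (norm (a k))\<^sup>2)"
  have A: "(\<Sum>m<K. real (m + 1) powr \<alpha> * (norm (a m))\<^sup>2) \<le> A" for K
    unfolding A_def using dirichlet_space_taylor(2)[OF fD] by (intro sum_le_suminf) (auto simp: a_def)
  \<comment> \<open>As \<open>\<alpha>\<close> is nonnegative, the Hardy norm is dominated, so the
    Szego kernel estimate applies.\<close>
  have A': "(\<Sum>m<K. (norm (a m))\<^sup>2) \<le> A" for K
  proof (rule order_trans[OF _ A[of K]], rule sum_mono)
    fix m
    have "1 * (norm (a m))\<^sup>2 \<le> real (m + 1) powr \<alpha> * (norm (a m))\<^sup>2"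
      using \<open>0 \<le> \<alpha>\<close> by (intro mult_right_mono ge_one_powr_ge_zero) auto
    then show "(norm (a m))\<^sup>2 \<le> real (m + 1) powr \<alpha> * (norm (a m))\<^sup>2" by simp
  qed
  have A0: "0 \<le> A" using A[of 0] by simp
  \<comment> \<open>The factor 2 is slack, since the infimum need not be attained.\<close>
  have small: "\<forall>\<^sub>F k in sequentially. norm (f (\<Lambda> k)) \<le> sqrt A * (2 * c)" if "c > 0" for c
    using landau_o.smallD[OF o that]
  proof eventually_elim
    case (elim k)
    have pos: "0 < sqrt (1 - norm (\<Lambda> k))" using \<Lambda>1 by simp
    have "(INF \<mu>\<in>M. pseudohyperbolic \<mu> (\<Lambda> k)) \<le> c * sqrt (1 - norm (\<Lambda> k))"
      using elim \<Lambda>1[of k] by simp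
    also have "\<dots> < 2 * c * sqrt (1 - norm (\<Lambda> k))" using that pos by simp
    finally obtain \<mu> where \<mu>: "\<mu> \<in> M" "pseudohyperbolic \<mu> (\<Lambda> k) < 2 * c * sqrt (1 - norm (\<Lambda> k))"
      using cInf_lessD[of "(\<lambda>\<mu>. pseudohyperbolic \<mu> (\<Lambda> k)) ` M"] M(2) by auto
    have "norm (f (\<Lambda> k)) \<le> sqrt A * pseudohyperbolic \<mu> (\<Lambda> k) / sqrt (1 - norm (\<Lambda> k))"
      by (rule norm_le_pseudohyperbolic[OF f A' \<Lambda>1]) (use \<mu>(1) M(1) fM in auto)
    also have "\<dots> \<le> sqrt A * (2 * c * sqrt (1 - norm (\<Lambda> k))) / sqrt (1 - norm (\<Lambda> k))"
      using \<mu>(2) pos A0 by (intro divide_right_mono mult_left_mono) auto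
    also have "\<dots> = sqrt A * (2 * c)" using pos by simp
    finally show ?case .
  qed
  have a0: "a n = 0" if n: "n \<in> N" for n
  proof -
    have "norm (a n) * (1 / 2) ^ n \<le> sqrt A * (5 * c)" if c: "c > 0" for c
    proof -
      obtain K where K: "\<And>k. k \<ge> K \<Longrightarrow> norm (f (\<Lambda> k)) \<le> sqrt A * (2 * c)"
        using small[OF c] unfolding eventually_sequentially by blast
      obtain J where J: "1 / Suc J < c" using c nat_approx_posE by blast
      \<comment> \<open>\<open>J\<close> gives the precision. \<open>K\<close> pushes the whole
        block past index \<open>K\<close>, because \<open>prod_encode\<close> dominates both of its
        arguments.\<close>
      define j where "j = max J K"
      have "1 / Suc j \<le> 1 / Suc J" by (intro divide_left_mono) (auto simp: j_def)
      then have jc: "1 / Suc j \<le> c" using J by linarith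
      have kK: "prod_encode (prod_encode (n, j), p) \<ge> K" for p
        using le_prod_encode_1[of "prod_encode (n, j)" p] le_prod_encode_2[of j n]
        by (simp add: j_def)
      have "norm (a n) * r n j ^ n \<le> 2 * (sqrt A * (2 * c)) + sqrt A * (1 / Suc j)"
      proof (rule norm_coeff_le_block[OF f A _ _ _ Q[OF n] _ _ \<phi>[OF n] F[OF n]])
        show "0 < r n j" using r[of n j] by linarith
        show "r n j < 1" using r by blast
        show "norm (f (of_real (r n j) * cis (2 * pi * i / Q n j + l * \<phi> n j))) \<le> sqrt A * (2 * c)"
          if "i < Q n j" "l < 2" for i l :: nat
          using K[OF kK[of "prod_encode (i, l)"]] \<Lambda>[OF n that] by simp
      qed (use fN in \<open>auto simp: a_def\<close>)
      also have "\<dots> \<le> 2 * (sqrt A * (2 * c)) + sqrt A * c"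
        using jc A0 by (intro add_left_mono mult_left_mono) auto
      also have "\<dots> = sqrt A * (5 * c)" by (simp add: algebra_simps)
      finally have "norm (a n) * r n j ^ n \<le> sqrt A * (5 * c)" .
      moreover have "norm (a n) * (1 / 2) ^ n \<le> norm (a n) * r n j ^ n"
        using r[of n j] by (intro mult_left_mono power_mono) auto
      ultimately show ?thesis by linarith
    qed
    note le = this
    have "norm (a n) * (1 / 2) ^ n \<le> 0 + x" if "x > 0" for x
    proof -
      \<comment> \<open>The added 1 covers \<open>A = 0\<close>.\<close>
      have "norm (a n) * (1 / 2) ^ n \<le> sqrt A * (5 * (x / (5 * (sqrt A + 1))))"
        using that A0 by (intro le divide_pos_pos) (auto intro: add_nonneg_pos)
      also have "\<dots> = x * (sqrt A / (sqrt A + 1))"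
        using A0 by (simp add: divide_simps add_nonneg_eq_0_iff)
      also have "\<dots> \<le> x * 1"
        using that A0 by (intro mult_left_mono) (auto simp: divide_le_eq_1 add_nonneg_pos)
      finally show ?thesis by simp
    qed
    then have "norm (a n) * (1 / 2) ^ n \<le> 0" by (rule field_le_epsilon)
    then show ?thesis
      using zero_less_power[of "1 / 2 :: real" n]
      by (metis half_gt_zero mult_pos_pos not_le zero_less_norm_iff zero_less_one)
  qed
  have "a k = 0" for k using a0[of k] fN by (auto simp: a_def)
  then show "f z = 0"
    using sums_unique2[OF f[of z] , of 0] z by simp
qed

theorem theorem1p2:
  fixes \<alpha> :: real and N :: "nat set" and t :: "nat \<Rightarrow> real"
  assumes "0 \<le> \<alpha>" and "\<alpha> \<le> 1"
    and "locally_sparse \<alpha> N"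
    and "incseq t" and "\<And>k. 0 < t k \<and> t k < 1"
  shows "\<exists>\<Lambda> :: nat \<Rightarrow> complex.
           (\<forall>k. \<Lambda> k \<in> ball 0 1 \<and> t k \<le> norm (\<Lambda> k)) \<and>
           uniqueness_pair \<alpha> (range \<Lambda>) N \<and>
           (\<forall>M. M \<subseteq> ball 0 1 \<and> M \<noteq> {} \<and>
                (\<lambda>k. INF \<mu>\<in>M. pseudohyperbolic \<mu> (\<Lambda> k)) \<in> o(\<lambda>k. sqrt (1 - norm (\<Lambda> k))) \<longrightarrow>
                uniqueness_pair \<alpha> M N)"
proof -
  have t: "0 < t k" "t k < 1" for k using assms(5) by auto
  define P where "P n j Q \<phi> \<longleftrightarrow> Q \<ge> 1 \<and> norm (1 + cis (n * \<phi>)) \<ge> 1 \<and>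
    (\<forall>F. finite F \<longrightarrow> F \<subseteq> {m \<in> N. m mod Q = n mod Q \<and> m \<noteq> n} \<longrightarrow>
       (\<Sum>m\<in>F. real (m + 1) powr - \<alpha> * (norm (1 + cis (m * \<phi>)))\<^sup>2) \<le> (1 / real (Suc j))\<^sup>2)"
    for n j Q :: nat and \<phi> :: real
  have "\<exists>Q \<phi>. P n j Q \<phi>" if "n \<in> N" for n j
  proof -
    have "0 < (1 / real (Suc j))\<^sup>2" by simp
    then show ?thesis
    proof (rule locally_sparse_block[OF assms(1,3) that])
      fix Q :: nat and \<phi> :: real
      assume "Q \<ge> 1" "norm (1 + cis (n * \<phi>)) \<ge> 1" and
        F: "\<And>F. finite F \<Longrightarrow> F \<subseteq> {m \<in> N. m mod Q = n mod Q \<and> m \<noteq> n} \<Longrightarrow>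
          (\<Sum>m\<in>F. real (m + 1) powr - \<alpha> * (norm (1 + cis (m * \<phi>)))\<^sup>2) \<le> (1 / real (Suc j))\<^sup>2"
      then have "P n j Q \<phi>" unfolding P_def by (intro conjI allI impI F)
      then show ?thesis by (intro exI)
    qed
  qed
  then obtain Q \<phi> where P: "n \<in> N \<Longrightarrow> P n j (Q n j) (\<phi> n j)" for n j
    by metis
  \<comment> \<open>\<open>B n j\<close> holds the indices of a block. It is finite, so one radius
    below 1 dominates \<open>t\<close> on all of it, although the size of the block was fixed
    first.\<close>
  define B where "B n j = (\<lambda>p. prod_encode (prod_encode (n, j), prod_encode p)) ` ({..<Q n j} \<times> {..<2::nat})" for n j
  define r where "r n j = Max (insert (1 / 2) (t ` B n j))" for n j
  have fin: "finite (insert (1 / 2) (t ` B n j))" for n j by (simp add: B_def)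
  have r: "1 / 2 \<le> r n j \<and> r n j < 1" for n j
    unfolding r_def using Max_ge[OF fin[of n j], of "1 / 2"] Max_less_iff[OF fin[of n j]] t by auto
  have rt: "t k \<le> r n j" if "k \<in> B n j" for n j k
    unfolding r_def using fin[of n j] that by (intro Max_ge) auto
  \<comment> \<open>Indices that encode no point of a block are filled with the irrelevant points \<open>t k\<close>.\<close>
  define \<Lambda> where "\<Lambda> k = (let (b, p) = prod_decode k; (n, j) = prod_decode b; (i, l) = prod_decode p in
      if i < Q n j \<and> l < 2 then of_real (r n j) * cis (2 * pi * i / Q n j + l * \<phi> n j) else of_real (t k))"
    for k
  have \<Lambda>: "\<Lambda> k \<in> ball 0 1 \<and> t k \<le> norm (\<Lambda> k)" for k
  proof -
    obtain n j i l where k: "k = prod_encode (prod_encode (n, j), prod_encode (i, l))"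
      by (metis prod_decode_inverse surj_pair)
    show ?thesis
    proof (cases "i < Q n j \<and> l < 2")
      case True
      then have "k \<in> B n j" by (auto simp: B_def k)
      then show ?thesis using True r[of n j] rt[of k n j]
        by (simp add: \<Lambda>_def k norm_mult)
    next
      case False
      then have "\<Lambda> k = of_real (t k)" by (auto simp: \<Lambda>_def k)
      then show ?thesis using t[of k] by simp
    qed
  qed
  have main: "uniqueness_pair \<alpha> M N"
    if "M \<subseteq> ball 0 1" "M \<noteq> {}"
      "(\<lambda>k. INF \<mu>\<in>M. pseudohyperbolic \<mu> (\<Lambda> k)) \<in> o(\<lambda>k. sqrt (1 - norm (\<Lambda> k)))" for M
    by (rule uniqueness_pair_blocks[OF assms(1) _ _ _ r _ _ that, where Q = Q and \<phi> = \<phi>])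
      (use P \<Lambda> in \<open>auto simp: P_def \<Lambda>_def\<close>)
  \<comment> \<open>The unperturbed set is the case of distance 0.\<close>
  have "(INF \<mu>\<in>range \<Lambda>. pseudohyperbolic \<mu> (\<Lambda> k)) = 0" for k
  proof (rule antisym)
    show "(INF \<mu>\<in>range \<Lambda>. pseudohyperbolic \<mu> (\<Lambda> k)) \<le> 0"
      by (rule cINF_lower2[where x = "\<Lambda> k"])
        (auto simp: pseudohyperbolic_def intro!: bdd_belowI[where m = 0])
    show "0 \<le> (INF \<mu>\<in>range \<Lambda>. pseudohyperbolic \<mu> (\<Lambda> k))"
      by (rule cINF_greatest) (auto simp: pseudohyperbolic_def)
  qed
  then have "uniqueness_pair \<alpha> (range \<Lambda>) N"
    using \<Lambda> by (intro main) auto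
  with \<Lambda> main show ?thesis by blast
qed

end
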